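(* Let $\gamma_n$ denote the maximal angle between a nonzero positive semidefinite $n\times n$ real symmetric matrix and a nonzero entrywise nonnegative $n\times n$ real symmetric matrix, and let $\theta_{\max}(\mathcal{C}_n)$ denote the maximal angle between two nonzero matrices in the cone $\mathcal{C}_n$ of $n\times n$ copositive matrices. Then $$\lim_{n\to\infty}\gamma_n=\lim_{n\to\infty}\theta_{\max}(\mathcal{C}_n)=\pi.$$
   Context: $\mathcal{S}_n$ is the space of real symmetric $n\times n$ matrices with inner product $\langle A,B\rangle=\operatorname{Tr}(AB)$ and the associated Frobenius norm $\|A\|=\sqrt{\sum_{i,j}a_{ij}^2}$. The angle between nonzero $A,B\in\mathcal{S}_n$ is $\angle(A,B)=\arccos\frac{\langle A,B\rangle}{\|A\|\,\|B\|}$. A symmetric matrix $A$ is copositive if $x^TAx\ge 0$ for every entrywise nonnegative vector $x$; $\mathcal{C}_n$ is the cone of $n\times n$ copositive matrices. $\mathcal{P}_n$ is the cone of $n\times n$ positive semidefinite matrices and $\mathcal{N}_n$ the cone of $n\times n$ symmetric entrywise nonnegative matrices. For a closed convex cone $K$, $\theta_{\max}(K)=\max\{\angle(u,v): u,v\in K\setminus\{0\}\}$, and $\gamma_n=\max\{\angle(X,Y): 0\ne X\in\mathcal{P}_n,\ 0\ne Y\in\mathcal{N}_n\}$. *)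

theory Defs
  imports Complex_Main "Jordan_Normal_Form.Matrix"
begin

definition sym_mats :: "nat \<Rightarrow> real mat set" where
  "sym_mats n = {A \<in> carrier_mat n n. transpose_mat A = A}"

definition mat_trace :: "real mat \<Rightarrow> real" where
  "mat_trace A = (\<Sum>i<dim_row A. A $$ (i, i))"

definition mat_inner :: "real mat \<Rightarrow> real mat \<Rightarrow> real" where
  "mat_inner A B = mat_trace (A * B)"

definition frobenius_norm :: "real mat \<Rightarrow> real" where
  "frobenius_norm A = sqrt (\<Sum>i<dim_row A. \<Sum>j<dim_col A. (A $$ (i, j))\<^sup>2)"

definition mat_angle :: "real mat \<Rightarrow> real mat \<Rightarrow> real" where
  "mat_angle A B = arccos (mat_inner A B / (frobenius_norm A * frobenius_norm B))"

definition copositive_cone :: "nat \<Rightarrow> real mat set" where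
  "copositive_cone n =
    {A \<in> sym_mats n. \<forall>x \<in> carrier_vec n. (\<forall>i<n. x $ i \<ge> 0) \<longrightarrow> x \<bullet> (A *\<^sub>v x) \<ge> 0}"

definition psd_cone :: "nat \<Rightarrow> real mat set" where
  "psd_cone n = {A \<in> sym_mats n. \<forall>x \<in> carrier_vec n. x \<bullet> (A *\<^sub>v x) \<ge> 0}"

definition nonneg_cone :: "nat \<Rightarrow> real mat set" where
  "nonneg_cone n = {A \<in> sym_mats n. \<forall>i<n. \<forall>j<n. A $$ (i, j) \<ge> 0}"

(* A genuine maximum, not a supremum: GREATEST is specified only if the maximum is attained.
   In particular nothing is known about the value for n = 0, where there is no nonzero matrix. *)
definition max_angle_between :: "nat \<Rightarrow> real mat set \<Rightarrow> real mat set \<Rightarrow> real" where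
  "max_angle_between n K L =
    (GREATEST t. \<exists>X \<in> K - {0\<^sub>m n n}. \<exists>Y \<in> L - {0\<^sub>m n n}. t = mat_angle X Y)"

definition theta_max :: "nat \<Rightarrow> real mat set \<Rightarrow> real" where
  "theta_max n K = max_angle_between n K K"

definition gamma_angle :: "nat \<Rightarrow> real" where
  "gamma_angle n = max_angle_between n (psd_cone n) (nonneg_cone n)"

end

theory Submission
  imports Defs "HOL-Computational_Algebra.Primes"
begin

text \<open>
  The maximal angles are attained, by compactness of the unit sphere of symmetric matrices, so it
  suffices to exhibit positive semidefinite matrices almost all of whose Frobenius norm sits in
  negative entries: such a matrix and its negative part enclose an angle close to \<open>\<pi>\<close>.

  Let \<open>p\<close> be an odd prime and \<open>d\<close> a nonresidue modulo \<open>p\<close>. Each \<open>(s, t) \<in> F\<^sub>p\<^sup>2\<close> colours \<open>x \<in> F\<^sub>p\<^sup>4\<close> by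
  \<open>x\<^sub>1 + x\<^sub>2 s + x\<^sub>3 t + x\<^sub>4 (s\<^sup>2 - d t\<^sup>2)\<close>; these functionals are the affine points of an elliptic quadric.
  The matrix with entries \<open>K(x, y) = p a(x, y) - p\<^sup>2\<close>, where \<open>a(x, y)\<close> counts the colourings in which \<open>x\<close> and
  \<open>y\<close> agree, is positive semidefinite by Cauchy-Schwarz on colour classes. Pairwise independence of
  the colourings bounds the squared norm of every row by \<open>p\<^sup>7\<close>, while \<open>(p - 1) p\<^sup>2\<close> entries of the row equal
  \<open>p - p\<^sup>2\<close>, because \<open>s\<^sup>2 - d t\<^sup>2\<close> is anisotropic. Hence the negative entries carry a fraction
  at least \<open>(1 - 1/p)\<^sup>3\<close> of the squared norm. Padding with zeros covers all dimensions \<open>n \<ge> p\<^sup>4\<close>.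
\<close>

section \<open>Attainment of the maximal angle between closed cones\<close>

text \<open>The Frobenius inner product. On symmetric matrices it is the trace form, and as a finite
  polynomial in the entries it passes to entrywise limits and splits along zero padding.\<close>

definition entry_sum :: "nat \<Rightarrow> real mat \<Rightarrow> real mat \<Rightarrow> real" where
  "entry_sum n A B = (\<Sum>i<n. \<Sum>j<n. A $$ (i, j) * B $$ (i, j))"

definition mat_cos :: "real mat \<Rightarrow> real mat \<Rightarrow> real" where
  "mat_cos A B = mat_inner A B / (frobenius_norm A * frobenius_norm B)"

text \<open>Closedness is stated sequentially and entrywise, so no topology on matrices of variable
  dimension enters. The limit is asked to lie in \<open>sym_mats n\<close> because convergence of
  the entries alone does not fix its dimensions.\<close>

definition closed_cone :: "nat \<Rightarrow> real mat set \<Rightarrow> bool" where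
  "closed_cone n K \<longleftrightarrow> K \<subseteq> sym_mats n \<and> (\<forall>A\<in>K. \<forall>c>0. c \<cdot>\<^sub>m A \<in> K) \<and>
    (\<forall>F. \<forall>A\<in>sym_mats n. (\<forall>k. F k \<in> K) \<longrightarrow>
      (\<forall>i<n. \<forall>j<n. (\<lambda>k::nat. F k $$ (i, j)) \<longlonglongrightarrow> A $$ (i, j)) \<longrightarrow> A \<in> K)"

lemma closed_coneD:
  assumes "closed_cone n K"
  shows "A \<in> K \<Longrightarrow> A \<in> sym_mats n"
    and "A \<in> K \<Longrightarrow> 0 < c \<Longrightarrow> c \<cdot>\<^sub>m A \<in> K"
    and "A \<in> sym_mats n \<Longrightarrow> (\<And>k. F k \<in> K) \<Longrightarrow>
      (\<And>i j. i < n \<Longrightarrow> j < n \<Longrightarrow> (\<lambda>k::nat. F k $$ (i, j)) \<longlonglongrightarrow> A $$ (i, j)) \<Longrightarrow> A \<in> K"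
  using assms unfolding closed_cone_def by blast+

lemma sym_mats_index:
  assumes "A \<in> sym_mats n" "i < n" "j < n"
  shows "A $$ (i, j) = A $$ (j, i)"
proof -
  have "A \<in> carrier_mat n n" "transpose_mat A = A"
    using assms(1) by (auto simp: sym_mats_def)
  then show ?thesis
    using assms(2,3) by (metis carrier_matD index_transpose_mat(1))
qed

lemma sym_matsI:
  assumes "A \<in> carrier_mat n n" "\<And>i j. i < n \<Longrightarrow> j < n \<Longrightarrow> A $$ (i, j) = A $$ (j, i)"
  shows "A \<in> sym_mats n"
  using assms by (auto simp: sym_mats_def intro!: eq_matI)

lemma mat_inner_eq_entry_sum:
  assumes "A \<in> sym_mats n" "B \<in> sym_mats n"
  shows "mat_inner A B = entry_sum n A B"
proof -
  have A: "A \<in> carrier_mat n n" and B: "B \<in> carrier_mat n n"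
    using assms by (auto simp: sym_mats_def)
  have "(A * B) $$ (i, i) = (\<Sum>j<n. A $$ (i, j) * B $$ (i, j))" if "i < n" for i
  proof -
    have "(A * B) $$ (i, i) = (\<Sum>j<n. A $$ (i, j) * B $$ (j, i))"
      using A B that by (simp add: scalar_prod_def atLeast0LessThan)
    also have "\<dots> = (\<Sum>j<n. A $$ (i, j) * B $$ (i, j))"
      by (rule sum.cong) (use that sym_mats_index[OF assms(2)] in auto)
    finally show ?thesis .
  qed
  then show ?thesis
    using A by (simp add: mat_inner_def mat_trace_def entry_sum_def)
qed

lemma frobenius_norm_eq:
  assumes "A \<in> sym_mats n"
  shows "frobenius_norm A = sqrt (entry_sum n A A)"
  using assms by (auto simp: sym_mats_def frobenius_norm_def entry_sum_def power2_eq_square)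

lemma entry_sum_self_pos:
  assumes "A \<in> sym_mats n" "A \<noteq> 0\<^sub>m n n"
  shows "0 < entry_sum n A A"
proof -
  have A: "A \<in> carrier_mat n n" using assms by (auto simp: sym_mats_def)
  obtain i j where ij: "i < n" "j < n" "A $$ (i, j) \<noteq> 0"
    using assms(2) A by (metis carrier_matD eq_matI index_zero_mat)
  have "0 < (\<Sum>j<n. A $$ (i, j) * A $$ (i, j))"
    by (rule sum_pos2[where i=j]) (use ij in \<open>auto simp: zero_less_mult_iff linorder_neq_iff\<close>)
  then show ?thesis
    unfolding entry_sum_def
    by (intro sum_pos2[where i=i and f="\<lambda>i. \<Sum>j<n. A $$ (i, j) * A $$ (i, j)"])
      (use ij in \<open>auto intro: sum_nonneg\<close>)
qed

lemma entry_sum_Cauchy_Schwarz: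
  assumes "0 < a" "0 < b" "entry_sum n A A = a\<^sup>2" "entry_sum n B B = b\<^sup>2"
  shows "- (a * b) \<le> entry_sum n A B" "entry_sum n A B \<le> a * b"
proof -
  \<comment> \<open>This is the expansion of the squared norm of \<open>b A + c a B\<close>. The
    signs \<open>c = 1\<close> and \<open>c = -1\<close> give the two bounds after division by
    \<open>2 a b\<close>.\<close>
  have *: "0 \<le> 2 * (a\<^sup>2 * b\<^sup>2) + 2 * c * (a * b) * entry_sum n A B" if "c\<^sup>2 = 1" for c
  proof -
    have "0 \<le> (\<Sum>i<n. \<Sum>j<n. (b * A $$ (i,j) + c * a * B $$ (i,j))\<^sup>2)"
      by (intro sum_nonneg) auto
    also have "\<dots> = b\<^sup>2 * entry_sum n A A + c\<^sup>2 * a\<^sup>2 * entry_sum n B B + 2 * c * (a * b) * entry_sum n A B"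
      unfolding entry_sum_def
      by (simp add: power2_eq_square sum.distrib sum_distrib_left algebra_simps)
    finally show ?thesis using assms that by (simp add: algebra_simps)
  qed
  have ab: "0 < 2 * (a * b)" using assms by simp
  have "0 \<le> (2 * (a * b)) * (a * b + entry_sum n A B)"
    using *[of 1] by (simp add: power2_eq_square algebra_simps)
  then show "- (a * b) \<le> entry_sum n A B"
    using ab by (simp add: zero_le_mult_iff) 
  have "0 \<le> (2 * (a * b)) * (a * b - entry_sum n A B)"
    using *[of "-1"] by (simp add: power2_eq_square algebra_simps)
  then show "entry_sum n A B \<le> a * b"
    using ab by (simp add: zero_le_mult_iff)
qed

lemma mat_cos_eq:
  assumes "A \<in> sym_mats n" "B \<in> sym_mats n"
  shows "mat_cos A B = entry_sum n A B / (sqrt (entry_sum n A A) * sqrt (entry_sum n B B))"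
  using assms by (simp add: mat_cos_def mat_inner_eq_entry_sum frobenius_norm_eq)

lemma mat_cos_bounds:
  assumes "A \<in> sym_mats n - {0\<^sub>m n n}" "B \<in> sym_mats n - {0\<^sub>m n n}"
  shows "-1 \<le> mat_cos A B" "mat_cos A B \<le> 1"
proof -
  let ?a = "sqrt (entry_sum n A A)" and ?b = "sqrt (entry_sum n B B)"
  have p: "0 < entry_sum n A A" "0 < entry_sum n B B"
    using assms entry_sum_self_pos by auto
  then have "0 < ?a" "0 < ?b" by auto
  then have "- (?a * ?b) \<le> entry_sum n A B" "entry_sum n A B \<le> ?a * ?b" "0 < ?a * ?b"
    using entry_sum_Cauchy_Schwarz[of ?a ?b n A B] p by auto
  then show "-1 \<le> mat_cos A B" "mat_cos A B \<le> 1"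
    using assms by (auto simp: mat_cos_eq field_simps)
qed

lemma entry_sum_smult:
  assumes "A \<in> carrier_mat n n" "B \<in> carrier_mat n n"
  shows "entry_sum n (a \<cdot>\<^sub>m A) (b \<cdot>\<^sub>m B) = a * b * entry_sum n A B"
  using assms unfolding entry_sum_def sum_distrib_left
  by (intro sum.cong refl) auto

text \<open>Bolzano-Weierstrass, one coordinate at a time: a monotone subsequence in the new
  coordinate converges by boundedness, and the earlier coordinates keep converging along it.\<close>

lemma convergent_subseq_finite:
  fixes f :: "nat \<Rightarrow> 'i \<Rightarrow> real"
  assumes "finite I" "\<And>i. i \<in> I \<Longrightarrow> Bseq (\<lambda>k. f k i)"
  shows "\<exists>r. strict_mono r \<and> (\<forall>i\<in>I. convergent (\<lambda>k. f (r k) i))"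
  using assms
proof (induction I rule: finite_induct)
  case empty
  then show ?case by (auto intro: exI[of _ "\<lambda>k. k"] strict_monoI)
next
  case (insert i I)
  then obtain r where r: "strict_mono r" "\<forall>i\<in>I. convergent (\<lambda>k. f (r k) i)" by auto
  obtain s where s: "strict_mono s" "monoseq (\<lambda>k. f (r (s k)) i)"
    using seq_monosub[of "\<lambda>k. f (r k) i"] by auto
  have "Bseq (\<lambda>k. f (r (s k)) i)"
    using insert.prems[of i] by (auto simp: Bseq_def)
  then have "convergent (\<lambda>k. f (r (s k)) i)"
    using s by (simp add: Bseq_monoseq_convergent)
  moreover have "convergent (\<lambda>k. f (r (s k)) j)" if "j \<in> I" for j
    using convergent_subseq_convergent[of "\<lambda>k. f (r k) j" s] r(2) that s(1) by (auto simp: o_def)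
  ultimately show ?case
    using strict_mono_o[OF r(1) s(1)] by (intro exI[of _ "r \<circ> s"]) (auto simp del: strict_mono_o simp: o_def)
qed

lemma unit_entry_bound:
  assumes "entry_sum n A A = 1" "i < n" "j < n"
  shows "\<bar>A $$ (i, j)\<bar> \<le> 1"
proof -
  have "A $$ (i, j) * A $$ (i, j) \<le> (\<Sum>j<n. A $$ (i, j) * A $$ (i, j))"
    by (rule member_le_sum) (use assms in auto)
  also have "\<dots> \<le> entry_sum n A A"
    unfolding entry_sum_def
    by (rule member_le_sum[where f="\<lambda>i. \<Sum>j<n. A $$ (i, j) * A $$ (i, j)"])
      (use assms in \<open>auto intro: sum_nonneg\<close>)
  finally have "(A $$ (i, j))\<^sup>2 \<le> 1" using assms by (simp add: power2_eq_square)
  then show ?thesis by (simp add: abs_square_le_1)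
qed

text \<open>Entries of a unit matrix lie between -1 and 1, so the finite-dimensional extraction
  applies to the index pairs; symmetry is inherited by the entrywise limits.\<close>

lemma unit_seq_limit:
  assumes "\<And>k::nat. F k \<in> sym_mats n" "\<And>k. entry_sum n (F k) (F k) = 1"
  shows "\<exists>r A. strict_mono r \<and> A \<in> sym_mats n \<and>
    (\<forall>i<n. \<forall>j<n. (\<lambda>k. F (r k) $$ (i, j)) \<longlonglongrightarrow> A $$ (i, j))"
proof -
  have "Bseq (\<lambda>k. F k $$ ij)" if "ij \<in> {..<n} \<times> {..<n}" for ij
    using that unit_entry_bound[OF assms(2)] by (intro BseqI[of 1]) auto
  then obtain r where r: "strict_mono r"
      "\<forall>ij\<in>{..<n} \<times> {..<n}. convergent (\<lambda>k. F (r k) $$ ij)"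
    using convergent_subseq_finite[of "{..<n} \<times> {..<n}" "\<lambda>k ij. F k $$ ij"] by auto
  define A where "A = mat n n (\<lambda>ij. lim (\<lambda>k. F (r k) $$ ij))"
  have "(\<lambda>k. F (r k) $$ (i, j)) \<longlonglongrightarrow> A $$ (i, j)" if "i < n" "j < n" for i j
    using r(2) that by (auto simp: A_def convergent_LIMSEQ_iff)
  moreover have "A \<in> sym_mats n"
    using sym_mats_index[OF assms(1)] by (intro sym_matsI) (auto simp: A_def)
  ultimately show ?thesis using r(1) by blast
qed

lemma entry_sum_tendsto:
  assumes "\<And>i j. i < n \<Longrightarrow> j < n \<Longrightarrow> (\<lambda>k::nat. F k $$ (i, j)) \<longlonglongrightarrow> A $$ (i, j)"
    and "\<And>i j. i < n \<Longrightarrow> j < n \<Longrightarrow> (\<lambda>k. G k $$ (i, j)) \<longlonglongrightarrow> B $$ (i, j)"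
  shows "(\<lambda>k. entry_sum n (F k) (G k)) \<longlonglongrightarrow> entry_sum n A B"
  unfolding entry_sum_def using assms by (intro tendsto_sum tendsto_mult) auto

lemma closed_cone_normalize:
  assumes "closed_cone n K" "A \<in> K - {0\<^sub>m n n}"
  shows "\<exists>c>0. c \<cdot>\<^sub>m A \<in> K \<and> entry_sum n (c \<cdot>\<^sub>m A) (c \<cdot>\<^sub>m A) = 1 \<and> c = 1 / sqrt (entry_sum n A A)"
proof -
  have A: "A \<in> sym_mats n" "A \<in> carrier_mat n n"
    using assms by (auto simp: closed_cone_def sym_mats_def)
  then have "0 < entry_sum n A A" using assms entry_sum_self_pos by auto
  then show ?thesis using assms A
    by (intro exI[of _ "1 / sqrt (entry_sum n A A)"])
      (auto simp: closed_cone_def entry_sum_smult)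
qed

text \<open>Pairs whose cosine approaches the infimum can be rescaled to unit norm without leaving
  the cones. On unit matrices the cosine is \<open>entry_sum\<close>, hence continuous, and
  compactness of the unit sphere yields a minimising pair.\<close>

lemma mat_cos_min_attained:
  assumes K: "closed_cone n K" and L: "closed_cone n L"
    and ne: "K - {0\<^sub>m n n} \<noteq> {}" "L - {0\<^sub>m n n} \<noteq> {}"
  shows "\<exists>X\<in>K - {0\<^sub>m n n}. \<exists>Y\<in>L - {0\<^sub>m n n}.
    \<forall>X'\<in>K - {0\<^sub>m n n}. \<forall>Y'\<in>L - {0\<^sub>m n n}. mat_cos X Y \<le> mat_cos X' Y'"
proof -
  let ?K = "K - {0\<^sub>m n n}" and ?L = "L - {0\<^sub>m n n}"
  have Ks: "K \<subseteq> sym_mats n" and Ls: "L \<subseteq> sym_mats n"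
    using K L by (auto simp: closed_cone_def)
  define C where "C = (\<lambda>(X, Y). mat_cos X Y) ` (?K \<times> ?L)"
  have bdd: "bdd_below C"
    using mat_cos_bounds(1)[of _ n] Ks Ls by (intro bdd_belowI[of _ "-1"]) (auto simp: C_def)
  have Cne: "C \<noteq> {}" using ne by (auto simp: C_def)
  have "\<forall>k. \<exists>Z. fst Z \<in> K \<and> snd Z \<in> L \<and> entry_sum n (fst Z) (fst Z) = 1 \<and>
      entry_sum n (snd Z) (snd Z) = 1 \<and> entry_sum n (fst Z) (snd Z) < Inf C + 1 / Suc k"
  proof
    fix k
    obtain c where "c \<in> C" "c < Inf C + 1 / Suc k"
      using cInf_lessD[OF Cne, of "Inf C + 1 / Suc k"] by auto
    then obtain X Y where XY: "X \<in> ?K" "Y \<in> ?L" "mat_cos X Y < Inf C + 1 / Suc k"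
      by (auto simp: C_def)
    obtain a where a: "a \<cdot>\<^sub>m X \<in> K" "entry_sum n (a \<cdot>\<^sub>m X) (a \<cdot>\<^sub>m X) = 1" "a = 1 / sqrt (entry_sum n X X)"
      using closed_cone_normalize[OF K XY(1)] by blast
    obtain b where b: "b \<cdot>\<^sub>m Y \<in> L" "entry_sum n (b \<cdot>\<^sub>m Y) (b \<cdot>\<^sub>m Y) = 1" "b = 1 / sqrt (entry_sum n Y Y)"
      using closed_cone_normalize[OF L XY(2)] by blast
    have "X \<in> sym_mats n" "Y \<in> sym_mats n" using XY Ks Ls by auto
    then have "entry_sum n (a \<cdot>\<^sub>m X) (b \<cdot>\<^sub>m Y) = mat_cos X Y"
      using a(3) b(3) by (subst entry_sum_smult) (auto simp: sym_mats_def mat_cos_eq)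
    then show "\<exists>Z. fst Z \<in> K \<and> snd Z \<in> L \<and> entry_sum n (fst Z) (fst Z) = 1 \<and>
      entry_sum n (snd Z) (snd Z) = 1 \<and> entry_sum n (fst Z) (snd Z) < Inf C + 1 / Suc k"
      using a(1,2) b(1,2) XY(3) by (intro exI[of _ "(a \<cdot>\<^sub>m X, b \<cdot>\<^sub>m Y)"]) simp
  qed
  from choice[OF this] obtain Z where Z: "\<forall>k. fst (Z k) \<in> K \<and> snd (Z k) \<in> L \<and>
      entry_sum n (fst (Z k)) (fst (Z k)) = 1 \<and> entry_sum n (snd (Z k)) (snd (Z k)) = 1 \<and>
      entry_sum n (fst (Z k)) (snd (Z k)) < Inf C + 1 / Suc k" ..
  define X Y where "X k = fst (Z k)" and "Y k = snd (Z k)" for k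
  have XY: "\<And>k. X k \<in> K" "\<And>k. Y k \<in> L"
      "\<And>k. entry_sum n (X k) (X k) = 1" "\<And>k. entry_sum n (Y k) (Y k) = 1"
      "\<And>k. entry_sum n (X k) (Y k) < Inf C + 1 / Suc k"
    using Z by (simp_all add: X_def Y_def)
  obtain r A where r: "strict_mono r" and A: "A \<in> sym_mats n"
      "\<And>i j. i < n \<Longrightarrow> j < n \<Longrightarrow> (\<lambda>k. X (r k) $$ (i, j)) \<longlonglongrightarrow> A $$ (i, j)"
    using unit_seq_limit[of X n] XY Ks by blast
  \<comment> \<open>The second extraction runs inside the first, so both sequences converge along
    the common subsequence \<open>r (s k)\<close>.\<close>
  obtain s B where s: "strict_mono s" and B: "B \<in> sym_mats n"
      "\<And>i j. i < n \<Longrightarrow> j < n \<Longrightarrow> (\<lambda>k. Y (r (s k)) $$ (i, j)) \<longlonglongrightarrow> B $$ (i, j)"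
    using unit_seq_limit[of "\<lambda>k. Y (r k)" n] XY Ls by blast
  have A2: "(\<lambda>k. X (r (s k)) $$ (i, j)) \<longlonglongrightarrow> A $$ (i, j)" if "i < n" "j < n" for i j
    using LIMSEQ_subseq_LIMSEQ[OF A(2)[OF that] s] by (simp add: o_def)
  have lim: "(\<lambda>k. entry_sum n (X (r (s k))) (X (r (s k)))) \<longlonglongrightarrow> entry_sum n A A"
     "(\<lambda>k. entry_sum n (Y (r (s k))) (Y (r (s k)))) \<longlonglongrightarrow> entry_sum n B B"
     "(\<lambda>k. entry_sum n (X (r (s k))) (Y (r (s k)))) \<longlonglongrightarrow> entry_sum n A B"
    using A2 B(2) by (auto intro: entry_sum_tendsto)
  \<comment> \<open>Unit norm survives the limit; this keeps both limits away from the zero matrix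
    and makes their cosine equal to \<open>entry_sum n A B\<close>.\<close>
  have AA: "entry_sum n A A = 1" "entry_sum n B B = 1"
    using lim(1,2) by (simp_all add: XY LIMSEQ_const_iff)
  have "(\<lambda>k. Inf C + 1 / Suc k) \<longlonglongrightarrow> Inf C + 0"
    by (intro tendsto_intros LIMSEQ_inverse_real_of_nat[unfolded inverse_eq_divide])
  then have "(\<lambda>k. Inf C + 1 / Suc (r (s k))) \<longlonglongrightarrow> Inf C"
    using LIMSEQ_subseq_LIMSEQ[OF _ strict_mono_o[OF r s], of "\<lambda>k. Inf C + 1 / Suc k"] by (simp add: o_def)
  then have "entry_sum n A B \<le> Inf C"
    by (rule LIMSEQ_le[OF lim(3)]) (use XY(5) in \<open>auto intro: less_imp_le\<close>)
  moreover have "mat_cos A B = entry_sum n A B" using A B AA by (simp add: mat_cos_eq)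
  moreover have "Inf C \<le> mat_cos X' Y'" if "X' \<in> ?K" "Y' \<in> ?L" for X' Y'
    using that bdd by (intro cInf_lower) (auto simp: C_def)
  ultimately have min: "mat_cos A B \<le> mat_cos X' Y'" if "X' \<in> ?K" "Y' \<in> ?L" for X' Y'
    using that order_trans by metis
  have "A \<in> ?K"
    using K A(1) A2 XY(1) AA closed_coneD(3)[of n K A "\<lambda>k. X (r (s k))"]
    by (auto simp: entry_sum_def)
  moreover have "B \<in> ?L"
    using L B XY(2) AA closed_coneD(3)[of n L B "\<lambda>k. Y (r (s k))"]
    by (auto simp: entry_sum_def)
  ultimately show ?thesis using min by blast
qed

text \<open>Since \<open>arccos\<close> is decreasing on [-1, 1], a pair with minimal cosine has
  maximal angle, so \<open>GREATEST\<close> denotes a genuine maximum. The given pair makes the set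
  of angles nonempty.\<close>

lemma max_angle_between_bounds:
  assumes "closed_cone n K" "closed_cone n L" "X \<in> K - {0\<^sub>m n n}" "Y \<in> L - {0\<^sub>m n n}"
  shows "arccos (mat_cos X Y) \<le> max_angle_between n K L" "max_angle_between n K L \<le> pi"
proof -
  let ?K = "K - {0\<^sub>m n n}" and ?L = "L - {0\<^sub>m n n}"
  have sub: "?K \<subseteq> sym_mats n - {0\<^sub>m n n}" "?L \<subseteq> sym_mats n - {0\<^sub>m n n}"
    using assms by (auto simp: closed_cone_def)
  obtain A B where AB: "A \<in> ?K" "B \<in> ?L"
      "\<forall>X'\<in>?K. \<forall>Y'\<in>?L. mat_cos A B \<le> mat_cos X' Y'"
    using mat_cos_min_attained[OF assms(1,2)] assms(3,4) by blast
  have le: "arccos (mat_cos X' Y') \<le> arccos (mat_cos A B)" if "X' \<in> ?K" "Y' \<in> ?L" for X' Y'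
  proof (rule arccos_le_arccos)
    show "mat_cos A B \<le> mat_cos X' Y'" using AB(3) that by blast
    show "-1 \<le> mat_cos A B" using mat_cos_bounds(1) AB(1,2) sub by (meson subsetD)
    show "mat_cos X' Y' \<le> 1" using mat_cos_bounds(2) that sub by (meson subsetD)
  qed
  have "max_angle_between n K L = arccos (mat_cos A B)"
    unfolding max_angle_between_def mat_angle_def mat_cos_def[symmetric]
  proof (rule Greatest_equality)
    show "\<exists>X\<in>?K. \<exists>Y\<in>?L. arccos (mat_cos A B) = arccos (mat_cos X Y)"
      using AB(1,2) by blast
  qed (use le in auto)
  then show "arccos (mat_cos X Y) \<le> max_angle_between n K L" "max_angle_between n K L \<le> pi"
    using le[OF assms(3,4)] mat_cos_bounds[of A n B] AB(1,2) sub by (auto intro!: arccos_ubound)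
qed

section \<open>Closedness of the three cones and the inclusions between them\<close>

lemma quadratic_form_eq:
  fixes A :: "real mat"
  assumes "A \<in> carrier_mat n n" "x \<in> carrier_vec n"
  shows "x \<bullet> (A *\<^sub>v x) = (\<Sum>i<n. \<Sum>j<n. x $ i * x $ j * A $$ (i, j))"
  using assms
  by (auto simp: scalar_prod_def atLeast0LessThan sum_distrib_left mult_ac intro!: sum.cong)

text \<open>For a fixed vector the condition is a weak linear inequality in the matrix entries, so
  it survives positive scaling and limits. Taking all vectors for \<open>S\<close> gives the
  semidefinite cone, taking the nonnegative ones the copositive cone.\<close>

lemma closed_cone_quadratic:
  assumes "S \<subseteq> carrier_vec n"
  shows "closed_cone n {A \<in> sym_mats n. \<forall>x\<in>S. x \<bullet> (A *\<^sub>v x) \<ge> 0}" (is "closed_cone n ?K")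
proof -
  have c: "A \<in> carrier_mat n n" if "A \<in> sym_mats n" for A using that by (simp add: sym_mats_def)
  have "c \<cdot>\<^sub>m A \<in> ?K" if "A \<in> ?K" "c > 0" for A c
  proof -
    have A: "A \<in> sym_mats n" using that by simp
    have "c \<cdot>\<^sub>m A \<in> sym_mats n"
      using c[OF A] sym_mats_index[OF A] by (intro sym_matsI) auto
    moreover have "x \<bullet> (c \<cdot>\<^sub>m A *\<^sub>v x) \<ge> 0" if "x \<in> S" for x
    proof -
      have "x \<in> carrier_vec n" using assms \<open>x \<in> S\<close> by auto
      then have "x \<bullet> (c \<cdot>\<^sub>m A *\<^sub>v x) = c * (x \<bullet> (A *\<^sub>v x))"
        using c[OF A] by (simp add: quadratic_form_eq[of _ n] sum_distrib_left mult_ac)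
      then show ?thesis using \<open>A \<in> ?K\<close> \<open>c > 0\<close> \<open>x \<in> S\<close> by simp
    qed
    ultimately show ?thesis by simp
  qed
  moreover have "A \<in> ?K" if A: "A \<in> sym_mats n" and F: "\<And>k. F k \<in> ?K"
      and lim: "\<And>i j. i < n \<Longrightarrow> j < n \<Longrightarrow> (\<lambda>k::nat. F k $$ (i, j)) \<longlonglongrightarrow> A $$ (i, j)" for F A
  proof -
    have "x \<bullet> (A *\<^sub>v x) \<ge> 0" if "x \<in> S" for x
    proof -
      have x: "x \<in> carrier_vec n" using assms that by auto
      have l: "(\<lambda>k. \<Sum>i<n. \<Sum>j<n. x $ i * x $ j * F k $$ (i, j)) \<longlonglongrightarrow>
          (\<Sum>i<n. \<Sum>j<n. x $ i * x $ j * A $$ (i, j))"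
        using lim by (intro tendsto_sum tendsto_mult tendsto_const) auto
      have nn: "(\<Sum>i<n. \<Sum>j<n. x $ i * x $ j * F k $$ (i, j)) \<ge> 0" for k
        using F[of k] that c x by (auto simp flip: quadratic_form_eq)
      have "(\<Sum>i<n. \<Sum>j<n. x $ i * x $ j * A $$ (i, j)) \<ge> 0"
        by (rule LIMSEQ_le_const[OF l]) (use nn in auto)
      then show ?thesis using c[OF A] x by (simp add: quadratic_form_eq)
    qed
    then show ?thesis using A by simp
  qed
  ultimately show ?thesis unfolding closed_cone_def by blast
qed

lemma closed_cone_psd: "closed_cone n (psd_cone n)"
  using closed_cone_quadratic[of "carrier_vec n" n] by (simp add: psd_cone_def)

lemma closed_cone_copositive: "closed_cone n (copositive_cone n)"
proof -
  have "copositive_cone n = {A \<in> sym_mats n. \<forall>x\<in>{x \<in> carrier_vec n. \<forall>i<n. x $ i \<ge> 0}. x \<bullet> (A *\<^sub>v x) \<ge> 0}"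
    by (auto simp: copositive_cone_def)
  then show ?thesis using closed_cone_quadratic[of "{x \<in> carrier_vec n. \<forall>i<n. x $ i \<ge> 0}" n] by auto
qed

lemma closed_cone_nonneg: "closed_cone n (nonneg_cone n)"
proof -
  have "c \<cdot>\<^sub>m A \<in> nonneg_cone n" if "A \<in> nonneg_cone n" "c > 0" for A c
  proof -
    have A: "A \<in> sym_mats n" using that by (simp add: nonneg_cone_def)
    then have "A \<in> carrier_mat n n" by (simp add: sym_mats_def)
    then show ?thesis using that sym_mats_index[OF A]
      by (auto simp: nonneg_cone_def intro!: sym_matsI)
  qed
  moreover have "A \<in> nonneg_cone n" if "A \<in> sym_mats n" and F: "\<And>k. F k \<in> nonneg_cone n"
      and lim: "\<And>i j. i < n \<Longrightarrow> j < n \<Longrightarrow> (\<lambda>k::nat. F k $$ (i, j)) \<longlonglongrightarrow> A $$ (i, j)" for F A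
    using that F by (auto simp: nonneg_cone_def intro!: LIMSEQ_le_const[OF lim])
  moreover have "nonneg_cone n \<subseteq> sym_mats n" by (auto simp: nonneg_cone_def)
  ultimately show ?thesis unfolding closed_cone_def by blast
qed

lemma psd_subset_copositive: "psd_cone n \<subseteq> copositive_cone n"
  by (auto simp: psd_cone_def copositive_cone_def)

lemma nonneg_subset_copositive: "nonneg_cone n \<subseteq> copositive_cone n"
proof
  fix A assume "A \<in> nonneg_cone n"
  then have A: "A \<in> sym_mats n" "A \<in> carrier_mat n n" "\<forall>i<n. \<forall>j<n. A $$ (i, j) \<ge> 0"
    by (auto simp: nonneg_cone_def sym_mats_def)
  then show "A \<in> copositive_cone n"
    by (auto simp: copositive_cone_def quadratic_form_eq intro!: sum_nonneg)
qed

section \<open>Kernels of colourings\<close>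

text \<open>Each summand is a scaled indicator of agreement with its mean removed, provided every
  colour has frequency 1/q. Keeping the sum over colourings lets positivity be checked for one
  colouring and the norm for pairs of colourings.\<close>

definition colour_kernel :: "'a set \<Rightarrow> ('a \<Rightarrow> 'b \<Rightarrow> 'c) \<Rightarrow> real \<Rightarrow> 'b \<Rightarrow> 'b \<Rightarrow> real" where
  "colour_kernel P c q x y = (\<Sum>a\<in>P. q * of_bool (c a x = c a y) - 1)"

lemma colour_kernel_commute: "colour_kernel P c q x y = colour_kernel P c q y x"
  unfolding colour_kernel_def by (simp add: eq_commute)

text \<open>Cauchy-Schwarz against the all-ones vector, read off from the nonnegative sum of scaled
  squared deviations from the mean.\<close>

lemma sum_squared_le_card_sum_squares:
  fixes g :: "'a \<Rightarrow> real"
  assumes "finite C" "C \<noteq> {}"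
  shows "(sum g C)\<^sup>2 \<le> card C * (\<Sum>k\<in>C. (g k)\<^sup>2)"
proof -
  define S where "S = sum g C"
  define q where "q = real (card C)"
  have q: "q > 0" using assms by (simp add: q_def card_gt_0_iff)
  have "0 \<le> (\<Sum>k\<in>C. (q * g k - S)\<^sup>2)" by (simp add: sum_nonneg)
  also have "\<dots> = q\<^sup>2 * (\<Sum>k\<in>C. (g k)\<^sup>2) - 2 * q * S * S + q * S\<^sup>2"
    by (simp add: power2_diff power_mult_distrib sum.distrib sum_subtractf sum_distrib_left
        sum_distrib_right S_def q_def mult_ac)
  also have "\<dots> = q * (q * (\<Sum>k\<in>C. (g k)\<^sup>2) - S\<^sup>2)"
    by (simp add: power2_eq_square algebra_simps)
  finally show ?thesis using q by (simp add: zero_le_mult_iff S_def q_def)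
qed

text \<open>For one colouring let \<open>g k\<close> be the total weight of \<open>u\<close> on
  colour \<open>k\<close>. The quadratic form is then the number of colours times the sum of the
  \<open>(g k)\<^sup>2\<close>, minus the square of the sum of the \<open>g k\<close>.\<close>

lemma colour_kernel_psd:
  fixes c :: "'a \<Rightarrow> 'b \<Rightarrow> 'c"
  assumes fin: "finite V" "finite C" and col: "\<And>a x. a \<in> P \<Longrightarrow> x \<in> V \<Longrightarrow> c a x \<in> C"
  shows "0 \<le> (\<Sum>x\<in>V. \<Sum>y\<in>V. u x * u y * colour_kernel P c (card C) x y)"
proof -
  have "0 \<le> (\<Sum>x\<in>V. \<Sum>y\<in>V. u x * u y * (real (card C) * of_bool (c a x = c a y) - 1))" (is "_ \<le> ?T")
    if a: "a \<in> P" for a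
  proof (cases "V = {}")
    case False
    define g where "g k = (\<Sum>x\<in>V. u x * of_bool (c a x = k))" for k
    have C: "C \<noteq> {}" using False col[OF a] by auto
    \<comment> \<open>Summing over the common colour \<open>k\<close> factors the agreement
      indicator into a part in \<open>x\<close> and a part in \<open>y\<close>.\<close>
    have ob: "of_bool (c a x = c a y) = (\<Sum>k\<in>C. of_bool (c a x = k) * of_bool (c a y = k) :: real)"
      if "x \<in> V" "y \<in> V" for x y
    proof -
      have "(\<Sum>k\<in>C. of_bool (c a x = k) * of_bool (c a y = k) :: real)
          = (\<Sum>k\<in>C. if k = c a x then of_bool (c a x = c a y) else 0)"
        by (rule sum.cong) auto
      then show ?thesis using fin col[OF a that(1)] by simp
    qed
    have "(\<Sum>x\<in>V. \<Sum>y\<in>V. u x * u y * of_bool (c a x = c a y))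
        = (\<Sum>x\<in>V. \<Sum>y\<in>V. \<Sum>k\<in>C. (u x * of_bool (c a x = k)) * (u y * of_bool (c a y = k)))"
      by (intro sum.cong refl) (simp only: ob sum_distrib_left mult_ac)
    also have "\<dots> = (\<Sum>x\<in>V. \<Sum>k\<in>C. \<Sum>y\<in>V. (u x * of_bool (c a x = k)) * (u y * of_bool (c a y = k)))"
      by (intro sum.cong refl sum.swap)
    also have "\<dots> = (\<Sum>k\<in>C. \<Sum>x\<in>V. \<Sum>y\<in>V. (u x * of_bool (c a x = k)) * (u y * of_bool (c a y = k)))"
      by (rule sum.swap)
    also have "\<dots> = (\<Sum>k\<in>C. (g k)\<^sup>2)"
      unfolding g_def power2_eq_square sum_product ..
    finally have 1: "(\<Sum>x\<in>V. \<Sum>y\<in>V. u x * u y * of_bool (c a x = c a y)) = (\<Sum>k\<in>C. (g k)\<^sup>2)" .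
    have "sum g C = (\<Sum>x\<in>V. \<Sum>k\<in>C. u x * of_bool (c a x = k))"
      unfolding g_def by (rule sum.swap)
    also have "\<dots> = sum u V"
    proof (rule sum.cong[OF refl])
      fix x assume "x \<in> V"
      have "(\<Sum>k\<in>C. u x * of_bool (c a x = k)) = (\<Sum>k\<in>C. if k = c a x then u x else 0)"
        by (rule sum.cong) auto
      then show "(\<Sum>k\<in>C. u x * of_bool (c a x = k)) = u x" using fin col[OF a \<open>x \<in> V\<close>] by simp
    qed
    finally have 2: "sum g C = sum u V" .
    have "?T = card C * (\<Sum>x\<in>V. \<Sum>y\<in>V. u x * u y * of_bool (c a x = c a y)) - (\<Sum>x\<in>V. \<Sum>y\<in>V. u x * u y)"
      by (simp add: algebra_simps sum_subtractf sum_distrib_left)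
    also have "\<dots> = card C * (\<Sum>k\<in>C. (g k)\<^sup>2) - (sum g C)\<^sup>2"
      by (simp only: 1 2 power2_eq_square sum_product)
    finally show ?thesis using sum_squared_le_card_sum_squares[OF fin(2) C, of g] by simp
  qed simp
  then have "0 \<le> (\<Sum>a\<in>P. \<Sum>x\<in>V. \<Sum>y\<in>V. u x * u y * (real (card C) * of_bool (c a x = c a y) - 1))"
    by (rule sum_nonneg)
  also have "\<dots> = (\<Sum>x\<in>V. \<Sum>a\<in>P. \<Sum>y\<in>V. u x * u y * (real (card C) * of_bool (c a x = c a y) - 1))"
    by (rule sum.swap)
  also have "\<dots> = (\<Sum>x\<in>V. \<Sum>y\<in>V. \<Sum>a\<in>P. u x * u y * (real (card C) * of_bool (c a x = c a y) - 1))"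
    by (intro sum.cong refl sum.swap)
  finally show ?thesis unfolding colour_kernel_def sum_distrib_left .
qed

lemma sum_of_bool_card:
  "finite V \<Longrightarrow> (\<Sum>y\<in>V. of_bool (Q y)) = real (card {y \<in> V. Q y})"
  by (simp add: of_bool_def sum.If_cases Int_def)

text \<open>The colourings are pairwise independent as functions of a uniformly random \<open>y\<close>, and
  uniform, so the centred indicators are uncorrelated and only the diagonal terms survive.\<close>

lemma colour_kernel_row_bound:
  fixes q :: real
  assumes fin: "finite V" "finite P" and q: "q \<ge> 0"
    and uniform: "\<And>a. a \<in> P \<Longrightarrow> q * card {y \<in> V. c a x = c a y} = card V"
    and indep: "\<And>a b. a \<in> P \<Longrightarrow> b \<in> P \<Longrightarrow> a \<noteq> b \<Longrightarrow>
      q\<^sup>2 * card {y \<in> V. c a x = c a y \<and> c b x = c b y} \<le> card V"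
  shows "(\<Sum>y\<in>V. (colour_kernel P c q x y)\<^sup>2) \<le> q * card P * card V"
proof -
  let ?e = "\<lambda>a y. of_bool (c a x = c a y) :: real"
  have term_le: "(\<Sum>y\<in>V. (q * ?e a y - 1) * (q * ?e b y - 1)) \<le> (if b = a then q * card V else 0)"
    if "a \<in> P" "b \<in> P" for a b
  proof -
    have "(\<Sum>y\<in>V. (q * ?e a y - 1) * (q * ?e b y - 1))
       = (\<Sum>y\<in>V. q\<^sup>2 * of_bool (c a x = c a y \<and> c b x = c b y) - q * ?e a y - q * ?e b y + 1)"
      by (rule sum.cong) (auto simp: algebra_simps power2_eq_square of_bool_conj)
    also have "\<dots> = q\<^sup>2 * card {y \<in> V. c a x = c a y \<and> c b x = c b y}
        - q * card {y \<in> V. c a x = c a y} - q * card {y \<in> V. c b x = c b y} + card V"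
      using fin by (simp add: sum.distrib sum_subtractf sum_of_bool_card Int_def flip: sum_distrib_left)
    \<comment> \<open>By uniformity each single-colouring term equals \<open>card V\<close>. What
      remains is at most 0 for distinct colourings by \<open>indep\<close>, and
      \<open>q * card V - card V\<close> on the diagonal.\<close>
    also have "\<dots> = q\<^sup>2 * card {y \<in> V. c a x = c a y \<and> c b x = c b y} - card V"
      using uniform that by simp
    also have "\<dots> \<le> (if b = a then q * card V else 0)"
    proof (cases "b = a")
      case True
      have "q\<^sup>2 * card {y \<in> V. c a x = c a y} = q * card V"
        using uniform[OF that(1)] by (simp add: power2_eq_square)
      then show ?thesis using True by simp
    qed (use indep[of a b] that in auto)
    finally show ?thesis .
  qed
  have "(\<Sum>y\<in>V. (colour_kernel P c q x y)\<^sup>2)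
      = (\<Sum>y\<in>V. \<Sum>a\<in>P. \<Sum>b\<in>P. (q * ?e a y - 1) * (q * ?e b y - 1))"
    unfolding colour_kernel_def power2_eq_square sum_product ..
  also have "\<dots> = (\<Sum>a\<in>P. \<Sum>y\<in>V. \<Sum>b\<in>P. (q * ?e a y - 1) * (q * ?e b y - 1))"
    by (rule sum.swap)
  also have "\<dots> = (\<Sum>a\<in>P. \<Sum>b\<in>P. \<Sum>y\<in>V. (q * ?e a y - 1) * (q * ?e b y - 1))"
    by (intro sum.cong refl sum.swap)
  also have "\<dots> \<le> (\<Sum>a\<in>P. \<Sum>b\<in>P. if b = a then q * card V else 0)"
    by (intro sum_mono term_le)
  also have "\<dots> = q * card P * card V"
    using fin by simp
  finally show ?thesis .
qed

section \<open>Arithmetic modulo p and the colourings from an elliptic quadric\<close>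

text \<open>If every residue were a square, squaring would be surjective and hence injective on the
  finite set of residues; but 1 and p - 1 have the same square and differ for p > 2.\<close>

lemma exists_quadratic_nonresidue:
  fixes p :: int
  assumes "p > 2"
  shows "\<exists>d. \<forall>s. \<not> p dvd s\<^sup>2 - d"
proof (rule ccontr)
  assume "\<not> ?thesis"
  then have *: "\<exists>s. p dvd s\<^sup>2 - d" for d by blast
  let ?R = "{0..<p}"
  have "?R \<subseteq> (\<lambda>s. s\<^sup>2 mod p) ` ?R"
  proof
    fix d assume d: "d \<in> ?R"
    obtain s where "p dvd s\<^sup>2 - d" using * by blast
    then have "s\<^sup>2 mod p = d mod p" by (simp add: mod_eq_dvd_iff)
    then have "(s mod p)\<^sup>2 mod p = d" using d by (simp add: power_mod)
    then show "d \<in> (\<lambda>s. s\<^sup>2 mod p) ` ?R"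
      using assms by (intro image_eqI[of _ _ "s mod p"]) auto
  qed
  then have "inj_on (\<lambda>s. s\<^sup>2 mod p) ?R"
    by (intro finite_surj_inj) auto
  moreover have "(p - 1)\<^sup>2 mod p = 1\<^sup>2 mod p"
    by (simp add: mod_eq_dvd_iff power2_eq_square algebra_simps)
  ultimately have "p - 1 = 1" using assms by (auto dest!: inj_onD[of _ _ "p - 1" 1])
  then show False using assms by simp
qed

text \<open>If t were invertible modulo p, dividing by its square would exhibit d as the square of
  s/t. So p divides t, and then also the square of s.\<close>

lemma anisotropic:
  fixes p :: int
  assumes p: "prime p" and d: "\<And>s. \<not> p dvd s\<^sup>2 - d" and "p dvd s\<^sup>2 - d * t\<^sup>2"
  shows "p dvd s \<and> p dvd t"
proof -
  have t: "p dvd t"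
  proof (rule ccontr)
    assume "\<not> p dvd t"
    then have "coprime t p" using p by (simp add: prime_imp_coprime coprime_commute)
    then obtain u v where uv: "u * t + v * p = 1"
      using bezout_int[of t p] by (metis coprime_imp_gcd_eq_1)
    \<comment> \<open>Here \<open>u\<close> is an inverse of \<open>t\<close> modulo
      \<open>p\<close>, so both summands on the right are multiples of \<open>p\<close>.\<close>
    have "(s * u)\<^sup>2 - d = u\<^sup>2 * (s\<^sup>2 - d * t\<^sup>2) + d * (u * t - 1) * (u * t + 1)"
      by (simp add: power2_eq_square algebra_simps)
    also have "u * t - 1 = p * (- v)" using uv by (simp add: algebra_simps)
    finally have "p dvd (s * u)\<^sup>2 - d" using assms(3) by (simp add: mult.assoc)
    then show False using d by blast
  qed
  then have "p dvd d * t * t" by simp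
  from dvd_add[OF assms(3) this] have "p dvd s\<^sup>2" by (simp add: power2_eq_square mult.assoc)
  then show ?thesis using t p prime_dvd_power by blast
qed

lemma residue_eqI:
  fixes p :: int
  shows "x \<in> {0..<p} \<Longrightarrow> y \<in> {0..<p} \<Longrightarrow> p dvd x - y \<Longrightarrow> x = y"
  by (metis atLeastLessThan_iff mod_eq_dvd_iff mod_pos_pos_trivial)

fun quadric_colour :: "int \<Rightarrow> int \<Rightarrow> int \<times> int \<Rightarrow> int \<times> int \<times> int \<times> int \<Rightarrow> int" where
  "quadric_colour p d (s, t) (x1, x2, x3, x4) = (x1 + x2 * s + x3 * t + x4 * (s\<^sup>2 - d * t\<^sup>2)) mod p"

definition residue_space :: "int \<Rightarrow> (int \<times> int \<times> int \<times> int) set" where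
  "residue_space p = {0..<p} \<times> {0..<p} \<times> {0..<p} \<times> {0..<p}"

lemma finite_residue_space [simp]: "finite (residue_space p)"
  by (simp add: residue_space_def)

lemma card_residue_space: "p > 0 \<Longrightarrow> real (card (residue_space p)) = of_int p ^ 4"
  by (simp add: residue_space_def card_cartesian_product power4_eq_xxxx)

text \<open>The first coordinate enters the colour with coefficient 1, so the other three can be
  chosen freely and determine it. This is the uniformity required by the row bound.\<close>

lemma card_colour_class:
  assumes "p > 0" "k \<in> {0..<p}"
  shows "real (card {y \<in> residue_space p. k = quadric_colour p d a y}) = of_int p ^ 3"
proof -
  obtain s t where a: "a = (s, t)" by (cases a)
  let ?R = "{0..<p}"
  let ?f = "\<lambda>(y2, y3, y4). ((k - (y2 * s + y3 * t + y4 * (s\<^sup>2 - d * t\<^sup>2))) mod p, y2, y3, y4)"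
  have key: "k = (y1 + b) mod p \<longleftrightarrow> y1 = (k - b) mod p" if "y1 \<in> ?R" for y1 b
  proof
    assume "k = (y1 + b) mod p"
    then have "(k - b) mod p = (y1 + b - b) mod p" by (metis mod_diff_left_eq)
    then show "y1 = (k - b) mod p" using that by simp
  next
    assume "y1 = (k - b) mod p"
    then have "(y1 + b) mod p = (k - b + b) mod p" by (metis mod_add_left_eq)
    then show "k = (y1 + b) mod p" using assms by simp
  qed
  have "{y \<in> residue_space p. k = quadric_colour p d a y} = ?f ` (?R \<times> ?R \<times> ?R)"
  proof (intro Set.equalityI subsetI)
    fix y assume y: "y \<in> {y \<in> residue_space p. k = quadric_colour p d a y}"
    obtain y1 y2 y3 y4 where [simp]: "y = (y1, y2, y3, y4)" by (cases y)
    show "y \<in> ?f ` (?R \<times> ?R \<times> ?R)"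
      using y key[of y1 "y2 * s + y3 * t + y4 * (s\<^sup>2 - d * t\<^sup>2)"]
      by (intro image_eqI[of _ _ "(y2, y3, y4)"]) (auto simp: residue_space_def a add.assoc)
  next
    fix y assume "y \<in> ?f ` (?R \<times> ?R \<times> ?R)"
    then obtain y2 y3 y4 where y: "y = ?f (y2, y3, y4)" "y2 \<in> ?R" "y3 \<in> ?R" "y4 \<in> ?R" by auto
    show "y \<in> {y \<in> residue_space p. k = quadric_colour p d a y}"
      using y assms key[of "(k - (y2 * s + y3 * t + y4 * (s\<^sup>2 - d * t\<^sup>2))) mod p"
          "y2 * s + y3 * t + y4 * (s\<^sup>2 - d * t\<^sup>2)"]
      by (auto simp: residue_space_def a add.assoc)
  qed
  moreover have "inj_on ?f (?R \<times> ?R \<times> ?R)" by (auto simp: inj_on_def)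
  ultimately show ?thesis
    using assms by (simp add: card_image card_cartesian_product power3_eq_cube)
qed

text \<open>Two distinct points (s, t) and (s', t') impose two independent linear conditions on four
  coordinates, so two coordinates determine the rest. This is the pairwise independence required by
  the row bound.\<close>

lemma card_two_colour_classes:
  assumes p: "prime p" and ab: "a \<in> {0..<p} \<times> {0..<p}" "b \<in> {0..<p} \<times> {0..<p}" "a \<noteq> b"
  shows "real (card {y \<in> residue_space p. k = quadric_colour p d a y \<and> l = quadric_colour p d b y})
    \<le> of_int p ^ 2" (is "real (card ?S) \<le> _")
proof -
  obtain s t s' t' where a: "a = (s, t)" and b: "b = (s', t')" by (cases a, cases b)
  have p0: "p > 0" using p by (simp add: prime_gt_0_int)
  let ?R = "{0..<p}"
  \<comment> \<open>With the fourth coordinate fixed, the two conditions differ by a relation with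
    coefficients s - s' and t - t'. So \<open>j\<close> retains the third coordinate when s - s' is
    invertible, and otherwise the second, since then t - t' is invertible.\<close>
  define j where "j = (\<lambda>(y1 :: int, y2, y3, y4). if s = s' then (y2, y4) else (y3 :: int, y4 :: int))"
  have "inj_on j ?S"
  proof (rule inj_onI)
    fix y z assume yz: "y \<in> ?S" "z \<in> ?S" and j: "j y = j z"
    obtain y1 y2 y3 y4 where y: "y = (y1, y2, y3, y4)" by (cases y)
    obtain z1 z2 z3 z4 where z: "z = (z1, z2, z3, z4)" by (cases z)
    have R: "y1 \<in> ?R" "y2 \<in> ?R" "y3 \<in> ?R" "y4 \<in> ?R" "z1 \<in> ?R" "z2 \<in> ?R" "z3 \<in> ?R" "z4 \<in> ?R"
      using yz by (auto simp: residue_space_def y z)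
    have 4: "y4 = z4" using j by (auto simp: j_def y z split: if_splits)
    have d1: "p dvd (y1 - z1) + (y2 - z2) * s + (y3 - z3) * t" (is "p dvd ?A")
      and d2: "p dvd (y1 - z1) + (y2 - z2) * s' + (y3 - z3) * t'" (is "p dvd ?B")
      using yz unfolding mem_Collect_eq by (auto simp: y z a b 4 mod_eq_dvd_iff algebra_simps)
    have d3: "p dvd (y2 - z2) * (s - s') + (y3 - z3) * (t - t')"
      using dvd_diff[OF d1 d2] by (simp add: algebra_simps)
    have "y2 = z2 \<and> y3 = z3"
    proof (cases "s = s'")
      case True
      then have 2: "y2 = z2" using j by (simp add: j_def y z)
      have "\<not> p dvd t - t'" using residue_eqI[of t p t'] True ab by (auto simp: a b)
      then have "p dvd y3 - z3" using d3 True p by (simp add: 2 prime_dvd_mult_iff)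
      then show ?thesis using 2 residue_eqI R by blast
    next
      case False
      then have 3: "y3 = z3" using j by (simp add: j_def y z)
      have "\<not> p dvd s - s'" using residue_eqI[of s p s'] False ab by (auto simp: a b)
      then have "p dvd y2 - z2" using d3 p by (simp add: 3 prime_dvd_mult_iff)
      then show ?thesis using 3 residue_eqI R by blast
    qed
    moreover from this have "y1 = z1" using d1 residue_eqI R by simp
    ultimately show "y = z" by (simp add: y z 4)
  qed
  moreover have "j ` ?S \<subseteq> ?R \<times> ?R" by (auto simp: j_def residue_space_def split: if_splits)
  ultimately have "card ?S \<le> card (?R \<times> ?R)" by (intro card_inj_on_le) auto
  then have "real (card ?S) \<le> real (card (?R \<times> ?R))" by (rule of_nat_mono)
  then show ?thesis using p0 by (simp add: card_cartesian_product power2_eq_square)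
qed

text \<open>A difference of the form \<open>w (s\<^sub>0\<^sup>2 - d t\<^sub>0\<^sup>2, - 2 s\<^sub>0, 2 d t\<^sub>0, 1)\<close> pairs with the point
  \<open>(s, t)\<close> to \<open>w ((s - s\<^sub>0)\<^sup>2 - d (t - t\<^sub>0)\<^sup>2)\<close>, which vanishes at \<open>(s\<^sub>0, t\<^sub>0)\<close> only.\<close>

lemma card_strongly_negative:
  assumes p: "prime p" "p > 2" and d: "\<And>s. \<not> p dvd s\<^sup>2 - d" and x: "x \<in> residue_space p"
  defines "K \<equiv> colour_kernel ({0..<p} \<times> {0..<p}) (quadric_colour p d) (of_int p)"
  shows "(of_int p - 1) * of_int p ^ 2 \<le> real (card {y \<in> residue_space p. K x y = of_int p - of_int p ^ 2})"
proof -
  let ?R = "{0..<p}"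
  obtain x1 x2 x3 x4 where x': "x = (x1, x2, x3, x4)" by (cases x)
  define h where "h = (\<lambda>(w, s, t). ((x1 + w * (s\<^sup>2 - d * t\<^sup>2)) mod p, (x2 - 2 * w * s) mod p,
      (x3 + 2 * w * d * t) mod p, (x4 + w) mod p))"
  \<comment> \<open>Invertibility of 2, \<open>d\<close> and \<open>w\<close> lets \<open>s\<close>
    and \<open>t\<close> be recovered from the second and third coordinates of \<open>h\<close>,
    once the fourth has given \<open>w\<close>.\<close>
  have p2: "\<not> p dvd 2" using p zdvd_not_zless[of 2 p] by simp
  have pd: "\<not> p dvd d" using d[of 0] by simp
  have pw: "\<not> p dvd w" if "w \<in> {1..<p}" for w using that zdvd_not_zless[of w p] by simp
  have "inj_on h ({1..<p} \<times> ?R \<times> ?R)"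
  proof (rule inj_onI)
    fix y z assume y: "y \<in> {1..<p} \<times> ?R \<times> ?R" and z: "z \<in> {1..<p} \<times> ?R \<times> ?R" and "h y = h z"
    obtain w s t w' s' t' where yz: "y = (w, s, t)" "z = (w', s', t')" by (cases y, cases z)
    have R: "w \<in> {1..<p}" "w' \<in> {1..<p}" "s \<in> ?R" "s' \<in> ?R" "t \<in> ?R" "t' \<in> ?R"
      and eq: "h (w, s, t) = h (w', s', t')"
      using y z \<open>h y = h z\<close> by (simp_all add: yz)
    have "p dvd w - w'" using eq by (simp add: h_def mod_eq_dvd_iff)
    then have w: "w = w'" using residue_eqI[of w p w'] R by auto
    have "p dvd 2 * w * (s' - s)" using eq by (simp add: h_def mod_eq_dvd_iff w algebra_simps)
    then have "s' = s" using residue_eqI[of s' p s] R p p2 pw by (auto simp: prime_dvd_mult_iff)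
    moreover have "p dvd 2 * w * d * (t - t')" using eq by (simp add: h_def mod_eq_dvd_iff w algebra_simps)
    then have "t = t'" using residue_eqI[of t p t'] R p p2 pw pd by (auto simp: prime_dvd_mult_iff)
    ultimately show "y = z" using w by (simp add: yz)
  qed
  moreover have "h ` ({1..<p} \<times> ?R \<times> ?R) \<subseteq> {y \<in> residue_space p. K x y = of_int p - of_int p ^ 2}"
  proof (rule image_subsetI)
    fix v assume v: "v \<in> {1..<p} \<times> ?R \<times> ?R"
    obtain w s0 t0 where v': "v = (w, s0, t0)" by (cases v)
    have R: "w \<in> {1..<p}" "s0 \<in> ?R" "t0 \<in> ?R" using v by (simp_all add: v')
    have agree: "quadric_colour p d a x = quadric_colour p d a (h (w, s0, t0)) \<longleftrightarrow> a = (s0, t0)"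
      if "a \<in> ?R \<times> ?R" for a
    proof -
      obtain s t where a: "a = (s, t)" by (cases a)
      have "quadric_colour p d a (h (w, s0, t0)) =
        ((x1 + w * (s0\<^sup>2 - d * t0\<^sup>2)) + (x2 - 2 * w * s0) * s + (x3 + 2 * w * d * t0) * t
          + (x4 + w) * (s\<^sup>2 - d * t\<^sup>2)) mod p"
        unfolding h_def a prod.case quadric_colour.simps by (intro mod_add_cong mod_mult_cong mod_mod_trivial refl)
      also have "\<dots> = (x1 + x2 * s + x3 * t + x4 * (s\<^sup>2 - d * t\<^sup>2) + w * ((s - s0)\<^sup>2 - d * (t - t0)\<^sup>2)) mod p"
        by (rule arg_cong[where f="\<lambda>x. x mod p"]) (simp add: power2_eq_square algebra_simps)
      finally have "quadric_colour p d a (h (w, s0, t0)) = quadric_colour p d a x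
          \<longleftrightarrow> p dvd w * ((s - s0)\<^sup>2 - d * (t - t0)\<^sup>2)"
        by (simp add: a x' mod_eq_dvd_iff)
      also have "\<dots> \<longleftrightarrow> p dvd (s - s0)\<^sup>2 - d * (t - t0)\<^sup>2"
        using p pw[OF R(1)] by (simp add: prime_dvd_mult_iff)
      also have "\<dots> \<longleftrightarrow> a = (s0, t0)"
        using anisotropic[OF p(1) d, of "s - s0" "t - t0"] residue_eqI[of s p s0] residue_eqI[of t p t0] R that
        by (auto simp: a)
      finally show ?thesis by auto
    qed
    have "K x (h (w, s0, t0)) = (\<Sum>a\<in>?R \<times> ?R. (if a = (s0, t0) then of_int p else 0) - 1)"
      unfolding K_def colour_kernel_def by (intro sum.cong refl) (simp add: agree)
    also have "\<dots> = (\<Sum>a\<in>?R \<times> ?R. if a = (s0, t0) then of_int p else 0) - card (?R \<times> ?R)"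
      by (simp add: sum_subtractf)
    also have "\<dots> = of_int p - of_int p ^ 2"
      using R p by (subst sum.delta) (auto simp: card_cartesian_product power2_eq_square)
    finally show "h v \<in> {y \<in> residue_space p. K x y = of_int p - of_int p ^ 2}"
      using p by (simp add: v' h_def residue_space_def)
  qed
  ultimately have "card ({1..<p} \<times> ?R \<times> ?R) \<le> card {y \<in> residue_space p. K x y = of_int p - of_int p ^ 2}"
    by (rule card_inj_on_le) simp
  then have "real (card ({1..<p} \<times> ?R \<times> ?R)) \<le> real (card {y \<in> residue_space p. K x y = of_int p - of_int p ^ 2})"
    by (rule of_nat_mono)
  then show ?thesis using p by (simp add: card_cartesian_product power2_eq_square)
qed

section \<open>Angles close to the straight angle\<close>

text \<open>Zero padding beyond the first m indices lets a kernel on a fixed set serve every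
  dimension from its cardinality onwards.\<close>

lemma padded_sum:
  fixes F :: "'a \<Rightarrow> 'a \<Rightarrow> real" and m n :: nat
  assumes e: "bij_betw e {..<m} V" and "m \<le> n"
  shows "(\<Sum>i<n. \<Sum>j<n. if i < m \<and> j < m then F (e i) (e j) else 0) = (\<Sum>x\<in>V. \<Sum>y\<in>V. F x y)"
proof -
  have "(\<Sum>i<n. \<Sum>j<n. if i < m \<and> j < m then F (e i) (e j) else 0)
      = (\<Sum>i<m. \<Sum>j<n. if i < m \<and> j < m then F (e i) (e j) else 0)"
    by (rule sum.mono_neutral_right) (use assms in auto)
  also have "\<dots> = (\<Sum>i<m. \<Sum>j<m. F (e i) (e j))"
    by (rule sum.cong[OF refl], rule sum.mono_neutral_cong_right) (use assms in auto)
  also have "\<dots> = (\<Sum>i<m. \<Sum>y\<in>V. F (e i) y)"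
    using sum.reindex_bij_betw[OF e] by metis
  also have "\<dots> = (\<Sum>x\<in>V. \<Sum>y\<in>V. F x y)"
    using sum.reindex_bij_betw[OF e, of "\<lambda>x. \<Sum>y\<in>V. F x y"] .
  finally show ?thesis .
qed

text \<open>The kernel is paired with its own negative part Y. Where Y is nonzero the kernel equals
  -Y, so the inner product is minus the squared norm of Y and the cosine is minus the ratio of the
  two norms.\<close>

lemma kernel_angle:
  fixes K :: "'a \<Rightarrow> 'a \<Rightarrow> real"
  assumes V: "finite V" "card V \<le> n"
    and sym: "\<And>x y. K x y = K y x"
    and psd: "\<And>u. 0 \<le> (\<Sum>x\<in>V. \<Sum>y\<in>V. u x * u y * K x y)"
    and pos: "0 < (\<Sum>x\<in>V. \<Sum>y\<in>V. (min 0 (K x y))\<^sup>2)"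
  shows "\<exists>X\<in>psd_cone n - {0\<^sub>m n n}. \<exists>Y\<in>nonneg_cone n - {0\<^sub>m n n}.
    mat_cos X Y = - sqrt ((\<Sum>x\<in>V. \<Sum>y\<in>V. (min 0 (K x y))\<^sup>2) / (\<Sum>x\<in>V. \<Sum>y\<in>V. (K x y)\<^sup>2))"
proof -
  define m where "m = card V"
  obtain e where e: "bij_betw e {..<m} V"
    using ex_bij_betw_nat_finite[OF V(1)] by (auto simp: m_def atLeast0LessThan)
  have mn: "m \<le> n" using V by (simp add: m_def)
  define M where "M F = mat n n (\<lambda>(i, j). if i < m \<and> j < m then F (e i) (e j) else (0::real))" for F
  have M_index: "M F $$ (i, j) = (if i < m \<and> j < m then F (e i) (e j) else 0)" if "i < n" "j < n" for F i j
    using that by (simp add: M_def)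
  define X Y where "X = M K" and "Y = M (\<lambda>x y. - min 0 (K x y))"
  define \<alpha> \<beta> where "\<alpha> = (\<Sum>x\<in>V. \<Sum>y\<in>V. (K x y)\<^sup>2)" and "\<beta> = (\<Sum>x\<in>V. \<Sum>y\<in>V. (min 0 (K x y))\<^sup>2)"
  have entry: "entry_sum n (M F) (M G) = (\<Sum>x\<in>V. \<Sum>y\<in>V. F x y * G x y)" for F G
    unfolding entry_sum_def padded_sum[OF e mn, symmetric]
    by (intro sum.cong refl) (simp add: M_index)
  have XX: "entry_sum n X X = \<alpha>" and YY: "entry_sum n Y Y = \<beta>"
    by (simp_all add: X_def Y_def entry \<alpha>_def \<beta>_def power2_eq_square)
  have XY: "entry_sum n X Y = - \<beta>"
    unfolding X_def Y_def entry \<beta>_def sum_negf[symmetric]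
    by (intro sum.cong refl) (auto simp: min_def power2_eq_square)
  have "M F \<in> sym_mats n" if "\<And>x y. F x y = F y x" for F
    using that by (intro sym_matsI) (auto simp: M_def)
  then have X: "X \<in> sym_mats n" and Y: "Y \<in> sym_mats n"
    using sym by (metis X_def, metis (no_types, lifting) Y_def)
  have \<beta>: "\<beta> > 0" using pos by (simp add: \<beta>_def)
  have "\<beta> \<le> \<alpha>" unfolding \<alpha>_def \<beta>_def by (intro sum_mono) (auto simp: min_def)
  then have \<alpha>: "\<alpha> > 0" using \<beta> by simp
  have "X \<in> psd_cone n"
  proof -
    have "0 \<le> v \<bullet> (X *\<^sub>v v)" if v: "v \<in> carrier_vec n" for v
    proof -
      \<comment> \<open>The test vector becomes a weight on \<open>V\<close> through the inverse of
        the enumeration; its coordinates from \<open>m\<close> on meet only zero entries.\<close>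
      define u where "u x = v $ (the_inv_into {..<m} e x)" for x
      have ue: "u (e i) = v $ i" if "i < m" for i
        using the_inv_into_f_f[of e "{..<m}" i] e that by (auto simp: u_def bij_betw_def)
      have "v \<bullet> (X *\<^sub>v v) = (\<Sum>i<n. \<Sum>j<n. v $ i * v $ j * X $$ (i, j))"
        using v X by (intro quadratic_form_eq) (auto simp: sym_mats_def)
      also have "\<dots> = (\<Sum>i<n. \<Sum>j<n. if i < m \<and> j < m then u (e i) * u (e j) * K (e i) (e j) else 0)"
        by (intro sum.cong refl) (simp add: X_def M_index ue)
      also have "\<dots> = (\<Sum>x\<in>V. \<Sum>y\<in>V. u x * u y * K x y)"
        by (rule padded_sum[OF e mn])
      finally show ?thesis using psd by simp
    qed
    then show ?thesis using X by (simp add: psd_cone_def)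
  qed
  moreover have "Y \<in> nonneg_cone n" using Y by (auto simp: nonneg_cone_def Y_def M_index)
  moreover have "X \<noteq> 0\<^sub>m n n" "Y \<noteq> 0\<^sub>m n n" using XX YY \<alpha> \<beta> by (auto simp: entry_sum_def)
  moreover have "mat_cos X Y = - sqrt (\<beta> / \<alpha>)"
  proof -
    have "mat_cos X Y = - (sqrt \<beta> * sqrt \<beta>) / (sqrt \<alpha> * sqrt \<beta>)"
      using X Y \<beta> by (simp add: mat_cos_eq XX YY XY)
    also have "\<dots> = - sqrt (\<beta> / \<alpha>)" using \<beta> by (simp add: real_sqrt_divide del: real_sqrt_mult_self)
    finally show ?thesis .
  qed
  ultimately show ?thesis unfolding \<alpha>_def \<beta>_def by blast
qed

text \<open>With q^4 rows, the squared norm is at most q^11. The entries q - q^2 contribute at least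
  (q - 1)^3 q^4 to each row and (q - 1)^3 q^8 in total, and the quotient is (1 - 1/q)^3.\<close>

lemma prime_kernel_angle:
  fixes p :: int
  assumes p: "prime p" "p > 2" and n: "nat p ^ 4 \<le> n"
  shows "\<exists>X\<in>psd_cone n - {0\<^sub>m n n}. \<exists>Y\<in>nonneg_cone n - {0\<^sub>m n n}.
    mat_cos X Y \<le> - sqrt ((1 - 1 / of_int p) ^ 3)"
proof -
  obtain d where d: "\<And>s. \<not> p dvd s\<^sup>2 - d" using exists_quadratic_nonresidue[OF p(2)] by blast
  define P where "P = {0..<p} \<times> {0..<p}"
  define V where "V = residue_space p"
  define q where "q = real_of_int p"
  define K where "K = colour_kernel P (quadric_colour p d) q"
  define \<alpha> \<beta> where "\<alpha> = (\<Sum>x\<in>V. \<Sum>y\<in>V. (K x y)\<^sup>2)" and "\<beta> = (\<Sum>x\<in>V. \<Sum>y\<in>V. (min 0 (K x y))\<^sup>2)"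
  have q: "q > 2" using p by (simp add: q_def)
  have p0: "p > 0" using p by simp
  have cV: "real (card V) = q ^ 4" using card_residue_space[OF p0] by (simp add: V_def q_def)
  have cP: "real (card P) = q\<^sup>2" using p by (simp add: P_def card_cartesian_product q_def power2_eq_square)
  have finV: "finite V" and finP: "finite P" by (simp_all add: V_def P_def)
  have colour: "quadric_colour p d a x \<in> {0..<p}" for a x
    using p by (cases "(p, d, a, x)" rule: quadric_colour.cases) auto
  have psd: "0 \<le> (\<Sum>x\<in>V. \<Sum>y\<in>V. u x * u y * K x y)" for u
  proof -
    have "real (card {0..<p}) = q" using p by (simp add: q_def)
    then show ?thesis
      using colour_kernel_psd[OF finV, of "{0..<p}" P "quadric_colour p d" u] colour by (simp add: K_def)
  qed
  have row: "(\<Sum>y\<in>V. (K x y)\<^sup>2) \<le> q ^ 7" for x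
  proof -
    have "(\<Sum>y\<in>V. (K x y)\<^sup>2) \<le> q * card P * card V"
      unfolding K_def
    proof (rule colour_kernel_row_bound[OF finV finP])
      show "q * real (card {y \<in> V. quadric_colour p d a x = quadric_colour p d a y}) = real (card V)" for a
        unfolding cV unfolding V_def card_colour_class[OF p0 colour] by (simp add: q_def eval_nat_numeral)
      fix a b assume ab: "a \<in> P" "b \<in> P" "a \<noteq> b"
      have "real (card {y \<in> V. quadric_colour p d a x = quadric_colour p d a y \<and>
          quadric_colour p d b x = quadric_colour p d b y}) \<le> q\<^sup>2"
        using card_two_colour_classes[OF p(1)] ab by (simp add: P_def V_def q_def)
      then have "q\<^sup>2 * real (card {y \<in> V. quadric_colour p d a x = quadric_colour p d a y \<and>
          quadric_colour p d b x = quadric_colour p d b y}) \<le> q\<^sup>2 * q\<^sup>2"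
        by (rule mult_left_mono) simp
      then show "q\<^sup>2 * real (card {y \<in> V. quadric_colour p d a x = quadric_colour p d a y \<and>
          quadric_colour p d b x = quadric_colour p d b y}) \<le> real (card V)"
        by (simp add: cV flip: power_add)
    qed (use q in simp)
    also have "\<dots> = q ^ 7" by (simp add: cP cV flip: power_add power_Suc)
    finally show ?thesis .
  qed
  have neg: "(q - 1) ^ 3 * q ^ 4 \<le> (\<Sum>y\<in>V. (min 0 (K x y))\<^sup>2)" if x: "x \<in> V" for x
  proof -
    let ?B = "{y \<in> V. K x y = q - q\<^sup>2}"
    have "(q - 1) * q\<^sup>2 \<le> real (card ?B)"
      using card_strongly_negative[OF p d, of x] x by (simp add: K_def V_def P_def q_def)
    then have "(q - 1) * q\<^sup>2 * (q - q\<^sup>2)\<^sup>2 \<le> real (card ?B) * (q - q\<^sup>2)\<^sup>2"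
      by (rule mult_right_mono) simp
    also have "(q - 1) * q\<^sup>2 * (q - q\<^sup>2)\<^sup>2 = (q - 1) ^ 3 * q ^ 4"
      by (simp add: eval_nat_numeral algebra_simps)
    also have "real (card ?B) * (q - q\<^sup>2)\<^sup>2 = (\<Sum>y\<in>?B. (min 0 (K x y))\<^sup>2)"
    proof -
      have "q - q\<^sup>2 \<le> 0" using q by (simp add: power2_eq_square)
      then show ?thesis by simp
    qed
    also have "\<dots> \<le> (\<Sum>y\<in>V. (min 0 (K x y))\<^sup>2)"
      by (rule sum_mono2) (use finV in auto)
    finally show ?thesis .
  qed
  have \<alpha>: "\<alpha> \<le> q ^ 11"
  proof -
    have "\<alpha> \<le> (\<Sum>x\<in>V. q ^ 7)" unfolding \<alpha>_def by (intro sum_mono row)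
    then show ?thesis by (simp add: cV flip: power_add)
  qed
  have \<beta>: "(q - 1) ^ 3 * q ^ 8 \<le> \<beta>"
  proof -
    have "(\<Sum>x\<in>V. (q - 1) ^ 3 * q ^ 4) \<le> \<beta>" unfolding \<beta>_def by (intro sum_mono neg)
    then show ?thesis by (simp add: cV eval_nat_numeral mult_ac)
  qed
  have "0 < (q - 1) ^ 3 * q ^ 8" using q by simp
  then have \<beta>0: "0 < \<beta>" using \<beta> by linarith
  have "\<beta> \<le> \<alpha>" unfolding \<alpha>_def \<beta>_def by (intro sum_mono) (auto simp: min_def)
  then have \<alpha>0: "0 < \<alpha>" using \<beta>0 by simp
  have "(1 - 1 / q) ^ 3 = ((q - 1) ^ 3 * q ^ 8) / q ^ 11"
    using q by (simp add: field_simps eval_nat_numeral)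
  also have "\<dots> \<le> \<beta> / \<alpha>" using \<alpha> \<beta> \<alpha>0 \<beta>0 by (intro frac_le) auto
  finally have le: "- sqrt (\<beta> / \<alpha>) \<le> - sqrt ((1 - 1 / q) ^ 3)" by simp
  have "card V = nat p ^ 4"
    using p by (simp add: V_def residue_space_def card_cartesian_product power4_eq_xxxx)
  then have "card V \<le> n" using n by simp
  moreover have "K x y = K y x" for x y unfolding K_def by (rule colour_kernel_commute)
  ultimately obtain X Y where "X \<in> psd_cone n - {0\<^sub>m n n}" "Y \<in> nonneg_cone n - {0\<^sub>m n n}"
      "mat_cos X Y = - sqrt (\<beta> / \<alpha>)"
    using kernel_angle[OF finV _ _ psd, of n] \<beta>0 unfolding \<alpha>_def \<beta>_def by blast
  then show ?thesis using le unfolding q_def by (intro bexI[of _ X] bexI[of _ Y]) simp_all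
qed

text \<open>A single sufficiently large prime p is chosen for the given c; padding then handles all
  dimensions from p^4 on, so no statement about gaps between primes enters.\<close>

lemma psd_nonneg_cos_near_minus_one:
  assumes "c > -1"
  shows "\<exists>N. \<forall>n\<ge>N. \<exists>X\<in>psd_cone n - {0\<^sub>m n n}. \<exists>Y\<in>nonneg_cone n - {0\<^sub>m n n}. mat_cos X Y \<le> c"
proof -
  have "(\<lambda>k::nat. - sqrt ((1 - 1 / of_nat k) ^ 3)) \<longlonglongrightarrow> - sqrt ((1 - 0) ^ 3)"
    by (intro tendsto_intros lim_1_over_n)
  then have "\<forall>\<^sub>F k in sequentially. - sqrt ((1 - 1 / real k) ^ 3) < c"
    by (rule order_tendstoD) (use assms in simp)
  then obtain k0 where k0: "\<And>k. k \<ge> k0 \<Longrightarrow> - sqrt ((1 - 1 / real k) ^ 3) < c"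
    by (auto simp: eventually_sequentially)
  obtain p :: nat where p: "prime p" "p > max k0 2" using bigger_prime by blast
  have "\<exists>X\<in>psd_cone n - {0\<^sub>m n n}. \<exists>Y\<in>nonneg_cone n - {0\<^sub>m n n}. mat_cos X Y \<le> c" if n: "n \<ge> p ^ 4" for n
  proof -
    have "prime (int p)" "2 < int p" "nat (int p) ^ 4 \<le> n" using p n by simp_all
    then obtain X Y where "X \<in> psd_cone n - {0\<^sub>m n n}" "Y \<in> nonneg_cone n - {0\<^sub>m n n}"
        "mat_cos X Y \<le> - sqrt ((1 - 1 / real_of_int (int p)) ^ 3)"
      using prime_kernel_angle by blast
    moreover have "- sqrt ((1 - 1 / real_of_int (int p)) ^ 3) \<le> c"
      using k0[of p] p(2) by simp
    ultimately show ?thesis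
      by (intro bexI[of _ X] bexI[of _ Y]) (rule order_trans)
  qed
  then show ?thesis by blast
qed

text \<open>Enlarging the cones can only increase the maximal angle, so the pairs found for the
  semidefinite and nonnegative cones bound it from below, while \<open>pi\<close> bounds it from
  above.\<close>

lemma max_angle_tendsto_pi:
  assumes "\<And>n. closed_cone n (K n)" "\<And>n. closed_cone n (L n)"
    and "\<And>n. psd_cone n \<subseteq> K n" "\<And>n. nonneg_cone n \<subseteq> L n"
  shows "(\<lambda>n. max_angle_between n (K n) (L n)) \<longlonglongrightarrow> pi"
proof (rule LIMSEQ_I)
  fix \<epsilon> :: real assume "0 < \<epsilon>"
  \<comment> \<open>The cap at \<open>pi\<close> keeps \<open>pi - \<delta>\<close> in the range
    where \<open>arccos\<close> inverts \<open>cos\<close>; halving \<epsilon> turns the weak bound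
    into the strict one demanded at the end.\<close>
  define \<delta> where "\<delta> = min (\<epsilon> / 2) pi"
  have \<delta>: "0 < \<delta>" "\<delta> \<le> pi" "\<delta> < \<epsilon>" using \<open>0 < \<epsilon>\<close> by (auto simp: \<delta>_def)
  have "cos pi < cos (pi - \<delta>)" using \<delta> by (intro cos_monotone_0_pi) auto
  then obtain N where N: "\<And>n. n \<ge> N \<Longrightarrow> \<exists>X\<in>psd_cone n - {0\<^sub>m n n}. \<exists>Y\<in>nonneg_cone n - {0\<^sub>m n n}.
      mat_cos X Y \<le> cos (pi - \<delta>)"
    using psd_nonneg_cos_near_minus_one[of "cos (pi - \<delta>)"] by auto
  have "norm (max_angle_between n (K n) (L n) - pi) < \<epsilon>" if n: "n \<ge> N" for n
  proof -
    obtain X Y where XY: "X \<in> psd_cone n - {0\<^sub>m n n}" "Y \<in> nonneg_cone n - {0\<^sub>m n n}"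
        "mat_cos X Y \<le> cos (pi - \<delta>)" using N[OF n] by blast
    have KL: "X \<in> K n - {0\<^sub>m n n}" "Y \<in> L n - {0\<^sub>m n n}" using XY assms(3,4) by auto
    have "-1 \<le> mat_cos X Y"
      using XY by (intro mat_cos_bounds(1)[of _ n]) (auto simp: psd_cone_def nonneg_cone_def)
    then have "arccos (cos (pi - \<delta>)) \<le> arccos (mat_cos X Y)"
      using XY(3) by (intro arccos_le_arccos) auto
    moreover have "arccos (cos (pi - \<delta>)) = pi - \<delta>" using \<delta> by (intro arccos_cos) auto
    ultimately show ?thesis
      using max_angle_between_bounds[OF assms(1,2) KL] \<delta> by (simp add: abs_le_iff)
  qed
  then show "\<exists>N. \<forall>n\<ge>N. norm (max_angle_between n (K n) (L n) - pi) < \<epsilon>" by blast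
qed

text \<open>Both limits are instances of the same squeeze: once with the semidefinite and
  nonnegative cones themselves, once with the copositive cone, which contains both, in each
  position.\<close>

theorem theorem1p1:
  shows "gamma_angle \<longlonglongrightarrow> pi \<and> (\<lambda>n. theta_max n (copositive_cone n)) \<longlonglongrightarrow> pi"
  unfolding gamma_angle_def[abs_def] theta_max_def
  using max_angle_tendsto_pi closed_cone_psd closed_cone_nonneg closed_cone_copositive
    psd_subset_copositive nonneg_subset_copositive by simp

end
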